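(* Let $X,Y$ be $n\times n$ Hermitian positive definite matrices. Let $A=\frac{X+Y}{2}$ and $G=X\sharp Y$; and let $P\in\mathbb{C}^{n\times k}$ ($k\le n$) have full column rank. Then $$\frac{\det(P^*AP)}{\det(P^*GP)}\le\frac{\det(A)}{\det(G)}.$$
   Context: $X\sharp Y:=X^{1/2}(X^{-1/2}YX^{-1/2})^{1/2}X^{1/2}$ is the matrix geometric mean. $P^*$ is the conjugate transpose of $P$. *)

theory Defs
  imports "Jordan_Normal_Form.Schur_Decomposition" "Jordan_Normal_Form.DL_Rank"
    "Jordan_Normal_Form.Gauss_Jordan_Elimination"
begin

text \<open>Matrices are those of \<^theory>\<open>Jordan_Normal_Form.Matrix\<close>. The order on
  \<^typ>\<open>complex\<close> is the one of \<^theory>\<open>HOL-Library.Complex_Order\<close>: \<open>x \<le> y\<close> means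
  \<open>Re x \<le> Re y\<close> and \<open>Im x = Im y\<close>, so \<open>0 \<le> z\<close> and \<open>0 < z\<close> include that \<open>z\<close> is real.\<close>

text \<open>\<^const>\<open>mat_adjoint\<close> is the conjugate transpose; the equation forces \<open>X\<close> to be square.\<close>

definition hermitian_mat :: "complex mat \<Rightarrow> bool" where
  "hermitian_mat X \<longleftrightarrow> mat_adjoint X = X"

text \<open>\<open>(X *\<^sub>v v) \<bullet>c v\<close> is \<open>v\<^sup>* X v\<close>, since \<open>\<bullet>c\<close> conjugates its second argument.\<close>

definition pos_def_mat :: "complex mat \<Rightarrow> bool" where
  "pos_def_mat X \<longleftrightarrow> hermitian_mat X \<and>
     (\<forall>v \<in> carrier_vec (dim_row X). v \<noteq> 0\<^sub>v (dim_row X) \<longrightarrow> 0 < (X *\<^sub>v v) \<bullet>c v)"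

definition pos_semidef_mat :: "complex mat \<Rightarrow> bool" where
  "pos_semidef_mat X \<longleftrightarrow> hermitian_mat X \<and>
     (\<forall>v \<in> carrier_vec (dim_row X). 0 \<le> (X *\<^sub>v v) \<bullet>c v)"

text \<open>The principal square root, meaningful only for positive semidefinite \<open>X\<close>.\<close>

definition sqrt_mat :: "complex mat \<Rightarrow> complex mat" where
  "sqrt_mat X = (THE B. pos_semidef_mat B \<and> B * B = X)"

text \<open>Unspecified if \<open>X\<close> is not invertible.\<close>

definition inv_mat :: "complex mat \<Rightarrow> complex mat" where
  "inv_mat X = the (mat_inverse X)"

definition geometric_mean_mat :: "complex mat \<Rightarrow> complex mat \<Rightarrow> complex mat" (infixl "\<sharp>" 70) where
  "X \<sharp> Y = sqrt_mat X * sqrt_mat (inv_mat (sqrt_mat X) * Y * inv_mat (sqrt_mat X)) * sqrt_mat X"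

end

theory Submission
  imports Defs "Jordan_Normal_Form.Spectral_Radius"
begin

text \<open>Let \<open>S = X\<^sup>1\<^sup>/\<^sup>2\<close> and \<open>T = (S\<inverse> Y S\<inverse>)\<^sup>1\<^sup>/\<^sup>2\<close>. Then \<open>X + Y - 2 (X \<sharp> Y) = S (1 - T)\<^sup>2 S\<close>, so
  \<open>G \<le> A\<close> in the Loewner order, and only this and positive definiteness are used from then on.
  If \<open>k < n\<close>, append to \<open>P\<close> a nonzero column \<open>v\<close> with \<open>P\<^sup>* A v = 0\<close>. This multiplies
  \<open>det (P\<^sup>* A P)\<close> by exactly \<open>v\<^sup>* A v\<close> and, by Fischer's inequality, \<open>det (P\<^sup>* G P)\<close> by at most
  \<open>v\<^sup>* G v \<le> v\<^sup>* A v\<close>. Hence the ratio of the two determinants does not decrease, and for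
  \<open>k = n\<close> it equals \<open>det A / det G\<close>.\<close>

section \<open>Conjugate transpose and congruence\<close>

lemma dim_mat_adjoint [simp]:
  "dim_row (mat_adjoint A) = dim_col A" "dim_col (mat_adjoint A) = dim_row A"
  by (auto simp: mat_adjoint_def)

lemma mat_adjoint_carrier [simp, intro]:
  "A \<in> carrier_mat m n \<Longrightarrow> mat_adjoint A \<in> carrier_mat n m"
  by auto

lemma index_mat_adjoint [simp]:
  "i < dim_col A \<Longrightarrow> j < dim_row A \<Longrightarrow> mat_adjoint A $$ (i, j) = conjugate (A $$ (j, i))"
  by (simp add: mat_adjoint_def mat_of_rows_index)

lemma mat_adjoint_eq_map: "mat_adjoint A = map_mat conjugate (transpose_mat A)"
  by (rule eq_matI) auto

lemma mat_adjoint_adjoint [simp]: "mat_adjoint (mat_adjoint A) = A"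
  by (rule eq_matI) auto

lemma mat_adjoint_mult:
  fixes A B :: "complex mat"
  assumes "A \<in> carrier_mat m n" "B \<in> carrier_mat n p"
  shows "mat_adjoint (A * B) = mat_adjoint B * mat_adjoint A"
  using assms by (intro eq_matI) (auto simp: scalar_prod_def mult.commute intro!: sum.cong)

lemma mat_adjoint_minus:
  fixes A B :: "complex mat"
  assumes "A \<in> carrier_mat m n" "B \<in> carrier_mat m n"
  shows "mat_adjoint (A - B) = mat_adjoint A - mat_adjoint B"
  using assms by (intro eq_matI) auto

lemma mat_adjoint_one [simp]: "mat_adjoint (1\<^sub>m n :: complex mat) = 1\<^sub>m n"
  by (rule eq_matI) auto

lemma mat_adjoint_zero [simp]: "mat_adjoint (0\<^sub>m m n :: complex mat) = 0\<^sub>m n m"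
  by (rule eq_matI) auto

lemma mat_adjoint_diag: "mat_adjoint (mat_diag n f :: complex mat) = mat_diag n (\<lambda>i. cnj (f i))"
  by (rule eq_matI) (auto simp: mat_diag_def)

lemma det_mat_adjoint:
  fixes A :: "complex mat"
  assumes "A \<in> carrier_mat n n"
  shows "det (mat_adjoint A) = cnj (det A)"
proof -
  interpret comm_ring_hom cnj by unfold_locales auto
  have "mat_adjoint A = map_mat cnj (transpose_mat A)"
    using mat_adjoint_eq_map[of A] by simp
  then show ?thesis using det_transpose[OF assms] by simp
qed

lemma cscalar_prod_cnj:
  fixes v w :: "complex vec"
  assumes "v \<in> carrier_vec n" "w \<in> carrier_vec n"
  shows "cnj (v \<bullet>c w) = w \<bullet>c v"
  using assms by (auto simp: scalar_prod_def mult.commute intro!: sum.cong)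

lemma cscalar_prod_adjoint:
  fixes A :: "complex mat"
  assumes A: "A \<in> carrier_mat m n" and v: "v \<in> carrier_vec n" and w: "w \<in> carrier_vec m"
  shows "(A *\<^sub>v v) \<bullet>c w = v \<bullet>c (mat_adjoint A *\<^sub>v w)"
proof -
  have "(A *\<^sub>v v) \<bullet>c w = (\<Sum>i<m. \<Sum>j<n. A $$ (i, j) * v $ j * cnj (w $ i))"
    using assms by (auto simp: scalar_prod_def sum_distrib_right atLeast0LessThan intro!: sum.cong)
  also have "\<dots> = (\<Sum>j<n. \<Sum>i<m. A $$ (i, j) * v $ j * cnj (w $ i))"
    by (rule sum.swap)
  also have "\<dots> = v \<bullet>c (mat_adjoint A *\<^sub>v w)"
    using assms by (auto simp: scalar_prod_def sum_distrib_left atLeast0LessThan intro!: sum.cong)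
  finally show ?thesis .
qed

lemma congruence_form:
  fixes M P :: "complex mat"
  assumes "M \<in> carrier_mat n n" "P \<in> carrier_mat n k" "v \<in> carrier_vec k" "w \<in> carrier_vec k"
  shows "((mat_adjoint P * M * P) *\<^sub>v v) \<bullet>c w = (M *\<^sub>v (P *\<^sub>v v)) \<bullet>c (P *\<^sub>v w)"
proof -
  have "mat_adjoint P * M \<in> carrier_mat k n"
    using assms by (intro mult_carrier_mat[of _ k n]) auto
  then have "(mat_adjoint P * M * P) *\<^sub>v v = mat_adjoint P *\<^sub>v (M *\<^sub>v (P *\<^sub>v v))"
    using assms assoc_mult_mat_vec[of "mat_adjoint P * M" k n P k v]
      assoc_mult_mat_vec[of "mat_adjoint P" k n M n "P *\<^sub>v v"] by auto
  then show ?thesis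
    using assms cscalar_prod_adjoint[of "mat_adjoint P" k n "M *\<^sub>v (P *\<^sub>v v)" w] by simp
qed

text \<open>Reduces entries of a congruence to values of the form of \<open>M\<close> at columns of
  \<open>P\<close>. With \<open>M = 1\<^sub>m n\<close> it gives the Gram matrix, so orthonormality
  of columns can be read off from \<open>P^* P = 1\<close>.\<close>

lemma index_congruence:
  fixes M P :: "complex mat"
  assumes M: "M \<in> carrier_mat n n" and P: "P \<in> carrier_mat n k" and "i < k" "j < k"
  shows "(mat_adjoint P * M * P) $$ (i, j) = (M *\<^sub>v col P j) \<bullet>c col P i"
proof -
  have c: "col P j \<in> carrier_vec n" "col P i \<in> carrier_vec n" using assms by auto
  have r: "row (mat_adjoint P) i = conjugate (col P i)"
    using assms by (intro eq_vecI) auto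
  have "(mat_adjoint P * M * P) $$ (i, j) = row (mat_adjoint P) i \<bullet> col (M * P) j"
    using assms by (subst assoc_mult_mat[of _ k n _ n _ k]) auto
  also have "\<dots> = (M *\<^sub>v col P j) \<bullet>c col P i"
    unfolding r col_mult2[OF M P \<open>j < k\<close>]
    by (rule comm_scalar_prod[OF carrier_vec_conjugate[OF c(2)] mult_mat_vec_carrier[OF M c(1)]])
  finally show ?thesis .
qed

lemma hermitian_congruence:
  fixes M P :: "complex mat"
  assumes M: "M \<in> carrier_mat n n" "hermitian_mat M" and P: "P \<in> carrier_mat n k"
  shows "hermitian_mat (mat_adjoint P * M * P)"
proof -
  have "mat_adjoint P * M \<in> carrier_mat k n"
    using assms by (intro mult_carrier_mat[of _ k n]) auto
  then have "mat_adjoint (mat_adjoint P * M * P) = mat_adjoint P * (mat_adjoint M * P)"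
    using M(1) P mat_adjoint_mult[of "mat_adjoint P * M" k n P k]
      mat_adjoint_mult[of "mat_adjoint P" k n M n] by auto
  also have "\<dots> = mat_adjoint P * M * P"
    using M P assoc_mult_mat[of "mat_adjoint P" k n M n P k] by (simp add: hermitian_mat_def)
  finally show ?thesis by (simp add: hermitian_mat_def)
qed

text \<open>The form of \<open>P^* M P\<close> at \<open>v\<close> is that of \<open>M\<close> at
  \<open>P v\<close>, and the trivial kernel keeps \<open>P v\<close> nonzero.\<close>

lemma pos_def_congruence:
  assumes M: "M \<in> carrier_mat n n" "pos_def_mat M" and P: "P \<in> carrier_mat n k"
    and inj: "\<And>v. v \<in> carrier_vec k \<Longrightarrow> P *\<^sub>v v = 0\<^sub>v n \<Longrightarrow> v = 0\<^sub>v k"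
  shows "pos_def_mat (mat_adjoint P * M * P)"
  unfolding pos_def_mat_def
proof (intro conjI ballI impI)
  show "hermitian_mat (mat_adjoint P * M * P)"
    using M P by (auto simp: pos_def_mat_def intro: hermitian_congruence)
  fix v :: "complex vec" assume v: "v \<in> carrier_vec (dim_row (mat_adjoint P * M * P))"
    "v \<noteq> 0\<^sub>v (dim_row (mat_adjoint P * M * P))"
  then have v': "v \<in> carrier_vec k" "v \<noteq> 0\<^sub>v k" using P by auto
  then have "P *\<^sub>v v \<noteq> 0\<^sub>v n" using inj by auto
  moreover have "P *\<^sub>v v \<in> carrier_vec n" using P v' by auto
  ultimately show "0 < ((mat_adjoint P * M * P) *\<^sub>v v) \<bullet>c v"
    using M P v' by (simp add: congruence_form[OF M(1) P] pos_def_mat_def)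
qed

lemma pos_def_imp_pos_semidef:
  assumes "pos_def_mat M"
  shows "pos_semidef_mat M"
  unfolding pos_semidef_mat_def
proof (intro conjI ballI)
  show "hermitian_mat M" using assms by (simp add: pos_def_mat_def)
  then have "dim_col M = dim_row M" unfolding hermitian_mat_def by (metis dim_mat_adjoint(1))
  fix v :: "complex vec" assume v: "v \<in> carrier_vec (dim_row M)"
  show "0 \<le> (M *\<^sub>v v) \<bullet>c v"
  proof (cases "v = 0\<^sub>v (dim_row M)")
    case True
    then show ?thesis by (auto simp: scalar_prod_def)
  next
    case False
    then show ?thesis using assms v by (auto simp: pos_def_mat_def less_imp_le)
  qed
qed

section \<open>Spectral theorem for Hermitian matrices\<close>

lemma mult_block_diag:
  fixes A B C D :: "'a :: comm_ring_1 mat"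
  assumes "A \<in> carrier_mat m p" "C \<in> carrier_mat r s" "B \<in> carrier_mat p q" "D \<in> carrier_mat s t"
  shows "four_block_mat A (0\<^sub>m m s) (0\<^sub>m r p) C * four_block_mat B (0\<^sub>m p t) (0\<^sub>m s q) D =
    four_block_mat (A * B) (0\<^sub>m m t) (0\<^sub>m r q) (C * D)"
  using assms mult_carrier_mat[OF assms(1,3)] mult_carrier_mat[OF assms(2,4)]
  by (subst mult_four_block_mat[of _ m p _ s _ r _ _ q _ t])
    (simp_all add: left_mult_zero_mat[of _ s t] left_mult_zero_mat[of _ p q]
      right_mult_zero_mat[of _ m p] right_mult_zero_mat[of _ r s])

text \<open>Extend \<open>v\<close> to a basis, apply Gram-Schmidt and normalise. Normalising
  rescales the first vector, hence the factor \<open>c\<close>; a multiple of an eigenvector serves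
  equally well.\<close>

lemma orthonormal_completion:
  fixes v :: "complex vec"
  assumes v: "v \<in> carrier_vec n" "v \<noteq> 0\<^sub>v n"
  obtains W c where "W \<in> carrier_mat n n" "mat_adjoint W * W = 1\<^sub>m n" "col W 0 = c \<cdot>\<^sub>v v"
proof -
  interpret cof_vec_space n "TYPE(complex)" .
  define ws where "ws = gram_schmidt n (basis_completion v)"
  have b: "set (basis_completion v) \<subseteq> carrier_vec n" "distinct (basis_completion v)"
    "\<not> lin_dep (set (basis_completion v))" "length (basis_completion v) = n"
    "hd (basis_completion v) = v"
    using basis_completion[OF v] by auto
  have n: "n \<noteq> 0" using v by auto
  have ws: "corthogonal ws" "set ws \<subseteq> carrier_vec n" "length ws = n"
    using gram_schmidt_result[OF b(1-3) ws_def] b(4) by auto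
  have wc: "ws ! i \<in> carrier_vec n" if "i < n" for i
    using ws that by (metis nth_mem subsetD)
  \<comment> \<open>Gram-Schmidt leaves the first vector of the list unchanged.\<close>
  have "hd ws = v"
    using gram_schmidt_hd[OF v(1), of "tl (basis_completion v)"] b(4,5) n
    unfolding ws_def by (cases "basis_completion v") auto
  then have ws0: "ws ! 0 = v" using n ws(3) by (metis hd_conv_nth list.size(3))
  \<comment> \<open>Gram-Schmidt yields orthogonal vectors that need not be unit vectors;
    \<open>r i\<close> is the norm by which the \<open>i\<close>-th one is divided.\<close>
  define r where "r i = sqrt (Re (ws ! i \<bullet>c ws ! i))" for i
  have r: "complex_of_real (r i) * complex_of_real (r i) = ws ! i \<bullet>c ws ! i" and r0: "r i \<noteq> 0" if "i < n" for i
  proof -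
    have "ws ! i \<bullet>c ws ! i \<noteq> 0" using ws that corthogonalD by blast
    moreover have "0 \<le> ws ! i \<bullet>c ws ! i" by (rule conjugate_square_ge_0_vec)
    ultimately show "complex_of_real (r i) * complex_of_real (r i) = ws ! i \<bullet>c ws ! i" "r i \<noteq> 0"
      unfolding r_def by (auto simp: less_eq_complex_def complex_eq_iff)
  qed
  define W where "W = mat_of_cols n (map (\<lambda>i. complex_of_real (1 / r i) \<cdot>\<^sub>v ws ! i) [0..<n])"
  have W: "W \<in> carrier_mat n n" unfolding W_def by auto
  have colW: "col W i = complex_of_real (1 / r i) \<cdot>\<^sub>v ws ! i" if "i < n" for i
    unfolding W_def using that wc by (subst col_mat_of_cols) auto
  have "mat_adjoint W * W = 1\<^sub>m n"
  proof (rule eq_matI)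
    fix i j assume "i < dim_row (1\<^sub>m n :: complex mat)" "j < dim_col (1\<^sub>m n :: complex mat)"
    then have ij: "i < n" "j < n" by auto
    have "(mat_adjoint W * W) $$ (i, j) = col W j \<bullet>c col W i"
      using index_congruence[OF one_carrier_mat W ij] W ij by auto
    also have "\<dots> = (ws ! j \<bullet>c ws ! i) / (complex_of_real (r i) * complex_of_real (r j))"
      unfolding colW[OF ij(1)] colW[OF ij(2)] using wc[OF ij(1)] wc[OF ij(2)]
      by (simp add: conjugate_smult_vec)
    also have "\<dots> = 1\<^sub>m n $$ (i, j)"
      using ws ij r[OF ij(1)] r0[OF ij(1)] corthogonalD[OF ws(1), of j i] by auto
    finally show "(mat_adjoint W * W) $$ (i, j) = 1\<^sub>m n $$ (i, j)" .
  qed (use W in auto)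
  with W colW[of 0] ws0 n show ?thesis by (intro that) auto
qed

text \<open>Induction by deflation: a unitary \<open>W\<close> whose first column is an eigenvector
  makes \<open>W^* A W\<close> block diagonal with blocks of sizes 1 and \<open>n\<close>, and the
  induction hypothesis diagonalises the second block.\<close>

theorem hermitian_diagonalization:
  fixes A :: "complex mat"
  assumes "A \<in> carrier_mat n n" "hermitian_mat A"
  shows "\<exists>U d. U \<in> carrier_mat n n \<and> mat_adjoint U * U = 1\<^sub>m n \<and> A = U * mat_diag n d * mat_adjoint U"
  using assms
proof (induction n arbitrary: A)
  case 0
  then show ?case by (intro exI[of _ "1\<^sub>m 0"] exI[of _ "\<lambda>_. 0"]) auto
next
  case (Suc n)
  let ?N = "Suc n"
  note A = Suc.prems(1) and hA = Suc.prems(2)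
  \<comment> \<open>The dimension is positive, so the complex matrix \<open>A\<close> has an
    eigenvalue.\<close>
  obtain v e where v: "v \<in> carrier_vec ?N" "v \<noteq> 0\<^sub>v ?N" and ev: "A *\<^sub>v v = e \<cdot>\<^sub>v v"
    using spectrum_non_empty[OF A] A by (auto simp: spectrum_def eigenvalue_def eigenvector_def)
  obtain W c where W: "W \<in> carrier_mat ?N ?N" and WW: "mat_adjoint W * W = 1\<^sub>m ?N"
    and W0: "col W 0 = c \<cdot>\<^sub>v v"
    using orthonormal_completion[OF v] by blast
  have WW': "W * mat_adjoint W = 1\<^sub>m ?N"
    using mat_mult_left_right_inverse[OF _ W WW] W by auto
  define B where "B = mat_adjoint W * A * W"
  have B: "B \<in> carrier_mat ?N ?N" unfolding B_def using A W by auto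
  have hB: "hermitian_mat B" unfolding B_def by (rule hermitian_congruence[OF A hA W])
  have sym: "B $$ (i, j) = cnj (B $$ (j, i))" if "i < ?N" "j < ?N" for i j
    using hB index_mat_adjoint[of i B j] that B by (auto simp: hermitian_mat_def)
  have ev0: "A *\<^sub>v col W 0 = e \<cdot>\<^sub>v col W 0"
    unfolding W0 using A v ev by (simp add: mult_mat_vec smult_smult_assoc mult.commute)
  \<comment> \<open>Column 0 of \<open>W\<close> is an eigenvector orthogonal to the other columns,
    so column 0 of \<open>B\<close> vanishes below the diagonal; by \<open>sym\<close> the same
    holds for row 0.\<close>
  have B0: "B $$ (i, 0) = 0" if "0 < i" "i < ?N" for i
  proof -
    have one: "1\<^sub>m ?N *\<^sub>v col W 0 = col W 0"
      using W col_dim[of W 0] by (intro one_mult_mat_vec) simp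
    have "B $$ (i, 0) = e * (col W 0 \<bullet>c col W i)"
      unfolding B_def using index_congruence[OF A W that(2), of 0] W that ev0
      by (auto simp: smult_scalar_prod_distrib[of _ ?N])
    also have "col W 0 \<bullet>c col W i = (mat_adjoint W * W) $$ (i, 0)"
      using index_congruence[OF one_carrier_mat W that(2), of 0] W that one by auto
    finally show ?thesis using WW that by auto
  qed
  define C where "C = mat n n (\<lambda>(i, j). B $$ (Suc i, Suc j))"
  define E where "E = mat 1 1 (\<lambda>_. B $$ (0, 0))"
  have C: "C \<in> carrier_mat n n" and E: "E \<in> carrier_mat 1 1" unfolding C_def E_def by auto
  have BC: "B = four_block_mat E (0\<^sub>m 1 n) (0\<^sub>m n 1) C"
  proof (rule eq_matI)
    fix i j assume "i < dim_row (four_block_mat E (0\<^sub>m 1 n) (0\<^sub>m n 1) C)"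
      "j < dim_col (four_block_mat E (0\<^sub>m 1 n) (0\<^sub>m n 1) C)"
    then have "i < ?N" "j < ?N" using C E by auto
    then show "B $$ (i, j) = four_block_mat E (0\<^sub>m 1 n) (0\<^sub>m n 1) C $$ (i, j)"
      using B0[of i] B0[of j] sym[of i j] C E by (auto simp: C_def E_def less_Suc_eq_0_disj)
  qed (use B C E in auto)
  have "hermitian_mat C"
    unfolding hermitian_mat_def by (rule eq_matI) (auto simp: C_def sym[symmetric])
  then obtain U d where U: "U \<in> carrier_mat n n" and UU: "mat_adjoint U * U = 1\<^sub>m n"
    and CU: "C = U * mat_diag n d * mat_adjoint U"
    using Suc.IH[OF C] by blast
  \<comment> \<open>\<open>V\<close> extends \<open>U\<close> by a leading 1 and \<open>f\<close>
    puts the corner entry of \<open>B\<close> before the eigenvalues \<open>d\<close>; the unitary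
    matrix sought is then \<open>W * V\<close>.\<close>
  define V where "V = four_block_mat (1\<^sub>m 1) (0\<^sub>m 1 n) (0\<^sub>m n 1) U"
  define f where "f i = (case i of 0 \<Rightarrow> B $$ (0, 0) | Suc j \<Rightarrow> d j)" for i
  have V: "V \<in> carrier_mat ?N ?N"
    unfolding V_def using U four_block_carrier_mat[of "1\<^sub>m 1" 1 1 U n n] by auto
  have adV: "mat_adjoint V = four_block_mat (1\<^sub>m 1) (0\<^sub>m 1 n) (0\<^sub>m n 1) (mat_adjoint U)"
    unfolding V_def using U by (intro eq_matI) auto
  have D: "mat_diag ?N f = four_block_mat E (0\<^sub>m 1 n) (0\<^sub>m n 1) (mat_diag n d)"
    using mat_diag_dim[of n d]
    by (intro eq_matI) (auto simp: mat_diag_def E_def f_def less_Suc_eq_0_disj)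
  have "mat_adjoint V * V = four_block_mat (1\<^sub>m 1) (0\<^sub>m 1 n) (0\<^sub>m n 1) (1\<^sub>m n)"
    unfolding adV unfolding V_def using U UU
    by (subst mult_block_diag[of _ 1 1 _ n n]) auto
  then have VV: "mat_adjoint V * V = 1\<^sub>m ?N" by auto
  have UD: "U * mat_diag n d \<in> carrier_mat n n" using U by auto
  have VD: "V * mat_diag ?N f = four_block_mat E (0\<^sub>m 1 n) (0\<^sub>m n 1) (U * mat_diag n d)"
    unfolding D V_def using U E UD
    by (subst mult_block_diag[of _ 1 1 _ n n]) auto
  have BV: "V * mat_diag ?N f * mat_adjoint V = B"
    unfolding adV BC CU VD using U E UD
    by (subst mult_block_diag[of _ 1 1 _ n n]) auto
  have WV: "W * V \<in> carrier_mat ?N ?N" using W V by auto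
  have aWV: "mat_adjoint (W * V) = mat_adjoint V * mat_adjoint W"
    by (rule mat_adjoint_mult[OF W V])
  have c: "mat_adjoint W \<in> carrier_mat ?N ?N" "mat_adjoint V \<in> carrier_mat ?N ?N"
    "mat_diag ?N f \<in> carrier_mat ?N ?N" using W V by auto
  have "mat_adjoint (W * V) * (W * V) = mat_adjoint V * (mat_adjoint W * W) * V"
    unfolding aWV using W V c by (simp add: assoc_mult_mat[of _ ?N ?N _ ?N _ ?N] mult_carrier_mat[of _ ?N ?N _ ?N])
  then have 1: "mat_adjoint (W * V) * (W * V) = 1\<^sub>m ?N" using VV WW V c by simp
  have "W * V * mat_diag ?N f * mat_adjoint (W * V) = W * (V * mat_diag ?N f * mat_adjoint V) * mat_adjoint W"
    unfolding aWV using W V c by (simp add: assoc_mult_mat[of _ ?N ?N _ ?N _ ?N] mult_carrier_mat[of _ ?N ?N _ ?N])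
  also have "\<dots> = (W * mat_adjoint W) * A * (W * mat_adjoint W)"
    unfolding BV unfolding B_def using W A c by (simp add: assoc_mult_mat[of _ ?N ?N _ ?N _ ?N] mult_carrier_mat[of _ ?N ?N _ ?N])
  also have "\<dots> = A" using WW' A by simp
  finally show ?case using WV 1 by metis
qed

text \<open>Multiplying the factorisation by \<open>U\<close> on the right cancels
  \<open>U^* U\<close>; the columns of the resulting \<open>A U = U D\<close> are the eigenvector
  equations.\<close>

lemma hermitian_orthonormal_eigenbasis:
  fixes A :: "complex mat"
  assumes A: "A \<in> carrier_mat n n" "hermitian_mat A"
  obtains U d where "U \<in> carrier_mat n n" "A = U * mat_diag n d * mat_adjoint U"
    "mat_adjoint U * U = 1\<^sub>m n"
    "\<And>i. i < n \<Longrightarrow> A *\<^sub>v col U i = d i \<cdot>\<^sub>v col U i" "\<And>i. i < n \<Longrightarrow> col U i \<bullet>c col U i = 1"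
proof -
  obtain U d where U: "U \<in> carrier_mat n n" and UU: "mat_adjoint U * U = 1\<^sub>m n"
    and AU: "A = U * mat_diag n d * mat_adjoint U"
    using hermitian_diagonalization[OF A] by blast
  have "A * U = U * mat_diag n d * (mat_adjoint U * U)"
    unfolding AU using U by (simp add: assoc_mult_mat[of _ n n _ n _ n] mult_carrier_mat[of _ n n _ n])
  then have AU': "A * U = U * mat_diag n d"
    using UU right_mult_one_mat[OF mult_carrier_mat[OF U mat_diag_dim]] by simp
  have "A *\<^sub>v col U i = d i \<cdot>\<^sub>v col U i" if "i < n" for i
  proof -
    have "A *\<^sub>v col U i = col (U * mat_diag n d) i"
      using AU' col_mult2[OF A(1) U that] by simp
    also have "\<dots> = d i \<cdot>\<^sub>v col U i"
      using U that by (intro eq_vecI) (auto simp: mat_diag_mult_right[OF U] mult.commute)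
    finally show ?thesis .
  qed
  moreover have "col U i \<bullet>c col U i = 1" if "i < n" for i
  proof -
    have "1\<^sub>m n *\<^sub>v col U i = col U i" using U by (intro one_mult_mat_vec) auto
    then show ?thesis
      using index_congruence[OF one_carrier_mat U that that] U UU that by auto
  qed
  ultimately show ?thesis using U UU AU that by blast
qed

lemma hermitian_form_swap:
  assumes "M \<in> carrier_mat n n" "hermitian_mat M" "v \<in> carrier_vec n" "w \<in> carrier_vec n"
  shows "cnj ((M *\<^sub>v v) \<bullet>c w) = (M *\<^sub>v w) \<bullet>c v"
  using assms cscalar_prod_adjoint[of M n n v w] cscalar_prod_cnj[of v n "M *\<^sub>v w"]
  by (simp add: hermitian_mat_def)

text \<open>Moving one factor across the inner product turns the form of a squared matrix into a
  squared norm when \<open>v = w\<close>, which is how square roots are exploited below.\<close>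

lemma hermitian_square_form:
  assumes "M \<in> carrier_mat n n" "hermitian_mat M" "v \<in> carrier_vec n" "w \<in> carrier_vec n"
  shows "((M * M) *\<^sub>v v) \<bullet>c w = (M *\<^sub>v v) \<bullet>c (M *\<^sub>v w)"
  using assms cscalar_prod_adjoint[of M n n "M *\<^sub>v v" w]
  by (simp add: hermitian_mat_def assoc_mult_mat_vec[of _ n n _ n])

section \<open>Positive semidefinite square roots\<close>

text \<open>The form at \<open>v\<close> is the sum of \<open>f i * |v i|^2\<close>.\<close>

lemma pos_semidef_diag:
  assumes "\<And>i. i < n \<Longrightarrow> 0 \<le> f i"
  shows "pos_semidef_mat (mat_diag n f)"
  unfolding pos_semidef_mat_def
proof (intro conjI ballI)
  have "cnj (f i) = f i" if "i < n" for i
    using assms[OF that] by (auto simp: less_eq_complex_def complex_eq_iff)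
  then show "hermitian_mat (mat_diag n f)"
    unfolding hermitian_mat_def mat_adjoint_diag by (intro eq_matI) (auto simp: mat_diag_def)
  fix v :: "complex vec" assume "v \<in> carrier_vec (dim_row (mat_diag n f))"
  then have v: "v \<in> carrier_vec n" by (simp add: mat_diag_def)
  have "(mat_diag n f *\<^sub>v v) $ i = f i * v $ i" if "i < n" for i
  proof -
    have "(mat_diag n f *\<^sub>v v) $ i = (\<Sum>j<n. (if i = j then f j else 0) * v $ j)"
      using v that by (auto simp: mat_diag_def scalar_prod_def atLeast0LessThan intro!: sum.cong)
    also have "\<dots> = (\<Sum>j<n. if j = i then f i * v $ i else 0)"
      by (intro sum.cong) auto
    finally show ?thesis using that by simp
  qed
  then have "(mat_diag n f *\<^sub>v v) \<bullet>c v = (\<Sum>i<n. f i * (v $ i * conjugate (v $ i)))"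
    using v by (auto simp: scalar_prod_def atLeast0LessThan mult.assoc intro!: sum.cong)
  also have "0 \<le> \<dots>"
    using assms by (intro sum_nonneg mult_nonneg_nonneg conjugate_square_positive) auto
  finally show "0 \<le> (mat_diag n f *\<^sub>v v) \<bullet>c v" .
qed

lemma pos_semidef_congruence:
  assumes M: "M \<in> carrier_mat n n" "pos_semidef_mat M" and P: "P \<in> carrier_mat n k"
  shows "pos_semidef_mat (mat_adjoint P * M * P)"
  unfolding pos_semidef_mat_def
proof (intro conjI ballI)
  show "hermitian_mat (mat_adjoint P * M * P)"
    using M P by (auto simp: pos_semidef_mat_def intro: hermitian_congruence)
  fix v :: "complex vec" assume "v \<in> carrier_vec (dim_row (mat_adjoint P * M * P))"
  then have v: "v \<in> carrier_vec k" using P by auto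
  then have "P *\<^sub>v v \<in> carrier_vec n" using P by auto
  then show "0 \<le> ((mat_adjoint P * M * P) *\<^sub>v v) \<bullet>c v"
    using M P v by (simp add: congruence_form[OF M(1) P] pos_semidef_mat_def)
qed

text \<open>Each eigenvalue is the value of the form at a unit eigenvector, hence nonnegative; take
  the roots of the eigenvalues in the same eigenbasis.\<close>

lemma pos_semidef_sqrt_exists:
  assumes M: "M \<in> carrier_mat n n" "pos_semidef_mat M"
  obtains B where "B \<in> carrier_mat n n" "pos_semidef_mat B" "B * B = M"
proof -
  have hM: "hermitian_mat M" using M by (simp add: pos_semidef_mat_def)
  obtain U d where U: "U \<in> carrier_mat n n" and MU: "M = U * mat_diag n d * mat_adjoint U"
    and UU: "mat_adjoint U * U = 1\<^sub>m n"
    and ev: "\<And>i. i < n \<Longrightarrow> M *\<^sub>v col U i = d i \<cdot>\<^sub>v col U i"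
    and n1: "\<And>i. i < n \<Longrightarrow> col U i \<bullet>c col U i = 1"
    using hermitian_orthonormal_eigenbasis[OF M(1) hM] by blast
  have d: "0 \<le> d i" if "i < n" for i
  proof -
    have u: "col U i \<in> carrier_vec n" using U that by auto
    then have "0 \<le> (M *\<^sub>v col U i) \<bullet>c col U i" using M by (auto simp: pos_semidef_mat_def)
    also have "\<dots> = d i * (col U i \<bullet>c col U i)"
      unfolding ev[OF that] using u by (simp add: smult_scalar_prod_distrib[of _ n])
    finally show ?thesis using n1[OF that] by simp
  qed
  define s where "s i = complex_of_real (sqrt (Re (d i)))" for i
  have ss: "s i * s i = d i" if "i < n" for i
    using d[OF that] by (auto simp: s_def less_eq_complex_def complex_eq_iff)
  define D where "D = mat_diag n s"
  \<comment> \<open>With this name \<open>U D V\<close> is the congruence \<open>V^* D V\<close>, so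
    it inherits semidefiniteness from \<open>D\<close>.\<close>
  define V where "V = mat_adjoint U"
  have D: "D \<in> carrier_mat n n" and V: "V \<in> carrier_mat n n" using U by (auto simp: D_def V_def)
  have DD: "D * D = mat_diag n d"
    unfolding D_def mat_diag_diag using ss by (intro eq_matI) (auto simp: mat_diag_def)
  have "pos_semidef_mat D" unfolding D_def
    using d by (intro pos_semidef_diag) (auto simp: s_def less_eq_complex_def)
  then have "pos_semidef_mat (mat_adjoint V * D * V)"
    by (rule pos_semidef_congruence[OF D _ V])
  then have 1: "pos_semidef_mat (U * D * V)" by (simp add: V_def)
  have "(U * D * V) * (U * D * V) = U * D * (V * U) * D * V"
    using U D V by (simp add: assoc_mult_mat[of _ n n _ n _ n] mult_carrier_mat[of _ n n _ n])
  also have "\<dots> = U * (D * D) * V"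
    using U D V UU by (simp add: assoc_mult_mat[of _ n n _ n _ n] mult_carrier_mat[of _ n n _ n] V_def)
  also have "\<dots> = M" unfolding DD MU V_def ..
  finally show ?thesis using 1 U D V by (intro that[of "U * D * V"]) auto
qed

text \<open>All eigenvalues of \<open>B - C\<close> are shown to vanish. At a unit eigenvector
  \<open>u\<close> for \<open>d\<close>, equality of the squares gives \<open>|B u| = |C u|\<close>,
  and expanding \<open>B u = C u + d u\<close> leaves an equation that forces
  \<open>d = 0\<close>.\<close>

lemma pos_semidef_sqrt_unique:
  assumes B: "B \<in> carrier_mat n n" "pos_semidef_mat B"
    and C: "C \<in> carrier_mat n n" "pos_semidef_mat C"
    and eq: "B * B = C * C"
  shows "B = C"
proof -
  have hB: "hermitian_mat B" and hC: "hermitian_mat C"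
    using B C by (auto simp: pos_semidef_mat_def)
  have BC: "B - C \<in> carrier_mat n n" using B C by auto
  have "hermitian_mat (B - C)"
    using hB hC mat_adjoint_minus[OF B(1) C(1)] by (simp add: hermitian_mat_def)
  then obtain U d where U: "U \<in> carrier_mat n n" and DU: "B - C = U * mat_diag n d * mat_adjoint U"
    and "mat_adjoint U * U = 1\<^sub>m n"
    and ev: "\<And>i. i < n \<Longrightarrow> (B - C) *\<^sub>v col U i = d i \<cdot>\<^sub>v col U i"
    and n1: "\<And>i. i < n \<Longrightarrow> col U i \<bullet>c col U i = 1"
    using hermitian_orthonormal_eigenbasis[OF BC] by blast
  have "d i = 0" if "i < n" for i
  proof -
    define u where "u = col U i"
    define p where "p = C *\<^sub>v u"
    have u: "u \<in> carrier_vec n" using U that by (auto simp: u_def)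
    have p: "p \<in> carrier_vec n" using C u by (auto simp: p_def)
    have "B *\<^sub>v u - p = d i \<cdot>\<^sub>v u"
      using ev[OF that] B C u minus_mult_distrib_mat_vec[OF B(1) C(1) u] by (simp add: u_def p_def)
    then have Bu: "B *\<^sub>v u = p + d i \<cdot>\<^sub>v u"
      using B u p by (auto simp: vec_eq_iff diff_eq_eq add.commute)
    have uu: "u \<bullet>c u = 1" using n1[OF that] by (simp add: u_def)
    have b: "0 \<le> (B *\<^sub>v u) \<bullet>c u" and c: "0 \<le> p \<bullet>c u"
      using B C u by (auto simp: pos_semidef_mat_def p_def)
    have db: "(B *\<^sub>v u) \<bullet>c u = p \<bullet>c u + d i"
      unfolding Bu using u p uu by (simp add: add_scalar_prod_distrib[of _ n])
    have cu: "u \<bullet>c p = p \<bullet>c u"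
      using cscalar_prod_cnj[OF p u] c by (auto simp: less_eq_complex_def complex_eq_iff)
    have dr: "cnj (d i) = d i" using b c db by (auto simp: less_eq_complex_def complex_eq_iff)
    have "p \<bullet>c p = (B *\<^sub>v u) \<bullet>c (B *\<^sub>v u)"
      using hermitian_square_form[OF B(1) hB u u] hermitian_square_form[OF C(1) hC u u] eq
      by (simp add: p_def)
    also have "\<dots> = p \<bullet>c p + 2 * d i * (p \<bullet>c u) + d i * d i"
      unfolding Bu using u p uu cu dr
      by (simp add: add_scalar_prod_distrib[of _ n] scalar_prod_add_distrib[of _ n]
          conjugate_add_vec[of _ n] conjugate_smult_vec algebra_simps)
    \<comment> \<open>The second factor is \<open>u^* B u + u^* C u\<close>. If this sum of
      nonnegative numbers is 0, both terms are 0, and so is their difference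
      \<open>d i\<close>.\<close>
    finally have "d i * (2 * (p \<bullet>c u) + d i) = 0"
      by (simp add: algebra_simps)
    then show "d i = 0" using b c db by (auto simp: less_eq_complex_def complex_eq_iff)
  qed
  then have "mat_diag n d = 0\<^sub>m n n" by (intro eq_matI) (auto simp: mat_diag_def)
  then have "B - C = 0\<^sub>m n n" using DU U by simp
  then show ?thesis using B C by (auto simp: mat_eq_iff)
qed

text \<open>Existence and uniqueness together resolve the definite description.\<close>

lemma sqrt_mat:
  assumes M: "M \<in> carrier_mat n n" "pos_semidef_mat M"
  shows "sqrt_mat M \<in> carrier_mat n n" "pos_semidef_mat (sqrt_mat M)" "sqrt_mat M * sqrt_mat M = M"
proof -
  obtain B where B: "B \<in> carrier_mat n n" "pos_semidef_mat B" "B * B = M"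
    using pos_semidef_sqrt_exists[OF M] by blast
  \<comment> \<open>The description does not mention the size of \<open>C\<close>; it is forced by
    the size of the product \<open>C * C\<close>.\<close>
  have sq: "C \<in> carrier_mat n n" if "pos_semidef_mat C" "C * C = M" for C
    using that M(1) by (metis carrier_matD(1) carrier_matD(2) carrier_matI index_mult_mat(2,3))
  have "sqrt_mat M = B"
    unfolding sqrt_mat_def
  proof (rule the_equality)
    fix C assume "pos_semidef_mat C \<and> C * C = M"
    then show "C = B" using pos_semidef_sqrt_unique[OF sq _ B(1,2)] B(3) by auto
  qed (use B in auto)
  then show "sqrt_mat M \<in> carrier_mat n n" "pos_semidef_mat (sqrt_mat M)" "sqrt_mat M * sqrt_mat M = M"
    using B by auto
qed

section \<open>Determinants and inverses of positive definite matrices\<close>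

lemma pos_def_det_nonzero:
  assumes M: "M \<in> carrier_mat n n" "pos_def_mat M"
  shows "det M \<noteq> 0"
proof
  assume "det M = 0"
  then obtain v where v: "v \<in> carrier_vec n" "v \<noteq> 0\<^sub>v n" "M *\<^sub>v v = 0\<^sub>v n"
    using det_0_iff_vec_prod_zero[OF M(1)] by auto
  then have "0 < (M *\<^sub>v v) \<bullet>c v" using M by (auto simp: pos_def_mat_def)
  then show False using v by simp
qed

text \<open>The determinant is the square of that of the Hermitian root, which is real and
  nonzero.\<close>

lemma pos_def_det_pos:
  assumes M: "M \<in> carrier_mat n n" "pos_def_mat M"
  shows "0 < det M"
proof -
  note S = sqrt_mat[OF M(1) pos_def_imp_pos_semidef[OF M(2)]]
  have "det M = det (sqrt_mat M) * det (sqrt_mat M)"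
    using det_mult[OF S(1) S(1)] S(3) by simp
  moreover have "cnj (det (sqrt_mat M)) = det (sqrt_mat M)"
    using det_mat_adjoint[OF S(1)] S(2) by (simp add: pos_semidef_mat_def hermitian_mat_def)
  ultimately show ?thesis
    using pos_def_det_nonzero[OF M] by (auto simp: less_complex_def complex_eq_iff zero_less_mult_iff linorder_neq_iff)
qed

text \<open>The form at \<open>v\<close> is the squared norm of
  \<open>sqrt_mat M *\<^sub>v v\<close>, and the root is injective because its determinant is
  nonzero too.\<close>

lemma pos_semidef_imp_pos_def:
  assumes M: "M \<in> carrier_mat n n" "pos_semidef_mat M" and "det M \<noteq> 0"
  shows "pos_def_mat M"
  unfolding pos_def_mat_def
proof (intro conjI ballI impI)
  show "hermitian_mat M" using M by (simp add: pos_semidef_mat_def)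
  note S = sqrt_mat[OF M]
  have hS: "hermitian_mat (sqrt_mat M)" using S by (simp add: pos_semidef_mat_def)
  have "det (sqrt_mat M) \<noteq> 0" using det_mult[OF S(1) S(1)] S(3) assms(3) by auto
  fix v :: "complex vec" assume "v \<in> carrier_vec (dim_row M)" "v \<noteq> 0\<^sub>v (dim_row M)"
  then have v: "v \<in> carrier_vec n" "v \<noteq> 0\<^sub>v n" using M by auto
  then have "sqrt_mat M *\<^sub>v v \<noteq> 0\<^sub>v n"
    using det_0_iff_vec_prod_zero[OF S(1)] \<open>det (sqrt_mat M) \<noteq> 0\<close> by auto
  moreover have "sqrt_mat M *\<^sub>v v \<in> carrier_vec n" using S v by auto
  ultimately show "0 < (M *\<^sub>v v) \<bullet>c v"
    using hermitian_square_form[OF S(1) hS v(1) v(1)] S(3) by simp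
qed

lemma inv_mat:
  assumes M: "M \<in> carrier_mat n n" "det M \<noteq> 0"
  shows "inv_mat M \<in> carrier_mat n n" "M * inv_mat M = 1\<^sub>m n" "inv_mat M * M = 1\<^sub>m n"
proof -
  \<comment> \<open>The argument \<open>()\<close> fixes the extension slot of the matrix ring
    record, so that both facts speak of units of the same ring.\<close>
  have "mat_inverse M \<noteq> None"
    using mat_inverse(1)[OF M(1), of "()"] det_non_zero_imp_unit[OF M, of "()"] by blast
  then obtain B where "mat_inverse M = Some B" by auto
  with mat_inverse(2)[OF M(1) this]
  show "inv_mat M \<in> carrier_mat n n" "M * inv_mat M = 1\<^sub>m n" "inv_mat M * M = 1\<^sub>m n"
    by (auto simp: inv_mat_def)
qed

text \<open>Taking adjoints in \<open>M * inv_mat M = 1\<close> shows that the adjoint of the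
  inverse is a left inverse of \<open>M\<close>, hence equal to the inverse.\<close>

lemma hermitian_inv_mat:
  assumes M: "M \<in> carrier_mat n n" "det M \<noteq> 0" "hermitian_mat M"
  shows "hermitian_mat (inv_mat M)"
proof -
  note R = inv_mat[OF M(1,2)]
  have aR: "mat_adjoint (inv_mat M) \<in> carrier_mat n n" using R by auto
  have "mat_adjoint (inv_mat M) * M = mat_adjoint (M * inv_mat M)"
    using mat_adjoint_mult[OF M(1) R(1)] M(3) by (simp add: hermitian_mat_def)
  then have "mat_adjoint (inv_mat M) * M = 1\<^sub>m n" using R by simp
  then have "mat_adjoint (inv_mat M) * M * inv_mat M = inv_mat M" using R by simp
  then show ?thesis
    using assoc_mult_mat[OF aR M(1) R(1)] R aR by (simp add: hermitian_mat_def)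
qed

section \<open>Arithmetic and geometric mean\<close>

text \<open>With \<open>w = S v\<close> and \<open>p = T w\<close>, the forms of \<open>X\<close>,
  \<open>Y\<close> and \<open>X \<sharp> Y\<close> at \<open>v\<close> are \<open>|w|^2\<close>,
  \<open>|p|^2\<close> and the inner product of \<open>p\<close> and \<open>w\<close>, so the
  comparison of the means is \<open>0 \<le> |w - p|^2\<close>.\<close>

lemma geometric_mean_mat:
  assumes X: "X \<in> carrier_mat n n" "pos_def_mat X" and Y: "Y \<in> carrier_mat n n" "pos_def_mat Y"
  shows geometric_mean_carrier: "X \<sharp> Y \<in> carrier_mat n n"
    and pos_def_geometric_mean: "pos_def_mat (X \<sharp> Y)"
    and geometric_mean_le_arithmetic_mean: "\<And>v. v \<in> carrier_vec n \<Longrightarrow>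
      ((X \<sharp> Y) *\<^sub>v v) \<bullet>c v \<le> (((1 / 2) \<cdot>\<^sub>m (X + Y)) *\<^sub>v v) \<bullet>c v"
proof -
  define S where "S = sqrt_mat X"
  define R where "R = inv_mat S"
  define Z where "Z = R * Y * R"
  define T where "T = sqrt_mat Z"
  have S: "S \<in> carrier_mat n n" "pos_semidef_mat S" "S * S = X"
    using sqrt_mat[OF X(1) pos_def_imp_pos_semidef[OF X(2)]] by (auto simp: S_def)
  have hS: "hermitian_mat S" using S by (simp add: pos_semidef_mat_def)
  have dS: "det S \<noteq> 0" using det_mult[OF S(1) S(1)] S(3) pos_def_det_nonzero[OF X] by auto
  have R: "R \<in> carrier_mat n n" "S * R = 1\<^sub>m n" "R * S = 1\<^sub>m n"
    using inv_mat[OF S(1) dS] by (auto simp: R_def)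
  have hR: "hermitian_mat R" unfolding R_def by (rule hermitian_inv_mat[OF S(1) dS hS])
  \<comment> \<open>A matrix with a left inverse has trivial kernel. Applied to \<open>R\<close> and
    to \<open>S\<close>, this supplies the kernel condition of the two congruences.\<close>
  have inj: "v = 0\<^sub>v n" if "M \<in> carrier_mat n n" "N \<in> carrier_mat n n" "M * N = 1\<^sub>m n"
    "v \<in> carrier_vec n" "N *\<^sub>v v = 0\<^sub>v n" for M N :: "complex mat" and v
  proof -
    have "v = (M * N) *\<^sub>v v" using that by simp
    also have "\<dots> = M *\<^sub>v (N *\<^sub>v v)" using that by (intro assoc_mult_mat_vec) auto
    also have "\<dots> = 0\<^sub>v n" unfolding that(5) using that(1) by (intro eq_vecI) auto
    finally show ?thesis .
  qed
  have Z: "Z \<in> carrier_mat n n" using R Y by (auto simp: Z_def)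
  have "pos_def_mat (mat_adjoint R * Y * R)"
    using inj[OF S(1) R(1,2)] by (intro pos_def_congruence[OF Y R(1)])
  then have pZ: "pos_def_mat Z" using hR by (simp add: Z_def hermitian_mat_def)
  have T: "T \<in> carrier_mat n n" "pos_semidef_mat T" "T * T = Z"
    using sqrt_mat[OF Z pos_def_imp_pos_semidef[OF pZ]] by (auto simp: T_def)
  have hT: "hermitian_mat T" using T by (simp add: pos_semidef_mat_def)
  have dT: "det T \<noteq> 0" using det_mult[OF T(1) T(1)] T(3) pos_def_det_nonzero[OF Z pZ] by auto
  have pT: "pos_def_mat T" by (rule pos_semidef_imp_pos_def[OF T(1,2) dT])
  \<comment> \<open>Writing one factor \<open>S\<close> as its own adjoint makes the geometric mean
    a congruence of \<open>T\<close>.\<close>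
  have G: "X \<sharp> Y = mat_adjoint S * T * S"
    using hS by (simp add: geometric_mean_mat_def S_def R_def Z_def T_def hermitian_mat_def)
  show 1: "X \<sharp> Y \<in> carrier_mat n n" unfolding G using S T by auto
  show 2: "pos_def_mat (X \<sharp> Y)" unfolding G
    using inj[OF R(1) S(1) R(3)] by (intro pos_def_congruence[OF T(1) pT S(1)])
  \<comment> \<open>Undoes the congruence by \<open>R\<close>, so that the form of \<open>Y\<close>
    becomes that of \<open>Z = T * T\<close> at \<open>w\<close>.\<close>
  have "S * Z * S = S * (R * (Y * (R * S)))"
    unfolding Z_def using S(1) R(1) Y(1)
    by (simp only: assoc_mult_mat[of _ n n _ n _ n] mult_carrier_mat[of _ n n _ n])
  also have "\<dots> = (S * R) * Y"
    using right_mult_one_mat[OF Y(1)] assoc_mult_mat[OF S(1) R(1) Y(1)] R(3) by simp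
  finally have SZS: "mat_adjoint S * Z * S = Y"
    using R Y hS by (simp add: hermitian_mat_def)
  fix v :: "complex vec" assume v: "v \<in> carrier_vec n"
  define w where "w = S *\<^sub>v v"
  define p where "p = T *\<^sub>v w"
  have w: "w \<in> carrier_vec n" and p: "p \<in> carrier_vec n" using S T v by (auto simp: w_def p_def)
  have fX: "(X *\<^sub>v v) \<bullet>c v = w \<bullet>c w"
    using hermitian_square_form[OF S(1) hS v v] S(3) by (simp add: w_def)
  have fY: "(Y *\<^sub>v v) \<bullet>c v = p \<bullet>c p"
    using congruence_form[OF Z S(1) v v] SZS hermitian_square_form[OF T(1) hT w w] T(3)
    by (simp add: w_def p_def)
  have fG: "((X \<sharp> Y) *\<^sub>v v) \<bullet>c v = p \<bullet>c w"
    using congruence_form[OF T(1) S(1) v v] G by (simp add: w_def p_def)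
  \<comment> \<open>The inner product is real, so the two cross terms in the expansion of
    \<open>|w - p|^2\<close> coincide.\<close>
  have "0 \<le> p \<bullet>c w" using T(1,2) w by (auto simp: p_def pos_semidef_mat_def)
  then have wp: "w \<bullet>c p = p \<bullet>c w"
    using cscalar_prod_cnj[OF p w] by (auto simp: less_eq_complex_def complex_eq_iff)
  have "0 \<le> (w - p) \<bullet>c (w - p)" by (rule conjugate_square_ge_0_vec)
  also have "(w - p) \<bullet>c (w - p) = w \<bullet>c w + p \<bullet>c p - 2 * (p \<bullet>c w)"
  proof -
    have "conjugate (w - p) = conjugate w - conjugate p"
      using w p by (intro eq_vecI) auto
    then show ?thesis using w p wp
      by (simp add: minus_scalar_prod_distrib[of _ n] scalar_prod_minus_distrib[of _ n])
  qed
  finally have "p \<bullet>c w \<le> (w \<bullet>c w + p \<bullet>c p) / 2"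
    by (auto simp: less_eq_complex_def)
  moreover have "(((1 / 2) \<cdot>\<^sub>m (X + Y)) *\<^sub>v v) \<bullet>c v = (w \<bullet>c w + p \<bullet>c p) / 2"
  proof -
    have "((1 / 2) \<cdot>\<^sub>m (X + Y)) *\<^sub>v v = (1 / 2) \<cdot>\<^sub>v ((X + Y) *\<^sub>v v)"
      using X Y v by (intro eq_vecI) auto
    also have "\<dots> \<bullet>c v = (1 / 2) * (((X + Y) *\<^sub>v v) \<bullet>c v)"
      using X Y v mult_mat_vec_carrier[of "X + Y" n n v]
      by (intro smult_scalar_prod_distrib[of _ n]) auto
    also have "(X + Y) *\<^sub>v v = X *\<^sub>v v + Y *\<^sub>v v"
      using X Y v by (intro add_mult_distrib_mat_vec) auto
    finally show ?thesis
      using X Y v fX fY by (simp add: add_scalar_prod_distrib[of _ n])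
  qed
  ultimately show "((X \<sharp> Y) *\<^sub>v v) \<bullet>c v \<le> (((1 / 2) \<cdot>\<^sub>m (X + Y)) *\<^sub>v v) \<bullet>c v"
    by (simp only: fG)
qed

section \<open>Determinants of compressions\<close>

text \<open>The Schur complement formula, with \<open>s = B^* M^{-1} B\<close>. Since
  \<open>s\<close> is nonnegative this contains Fischer's inequality for a border of width
  1.\<close>

lemma det_bordered:
  fixes M B :: "complex mat"
  assumes M: "M \<in> carrier_mat k k" "pos_def_mat M" and B: "B \<in> carrier_mat k 1"
  obtains s where "0 \<le> s"
    "det (four_block_mat M B (mat_adjoint B) (mat 1 1 (\<lambda>_. d))) = det M * (d - s)"
proof -
  define Z where "Z = inv_mat M * B"
  define D where "D = mat 1 1 (\<lambda>_. d)"
  note R = inv_mat[OF M(1) pos_def_det_nonzero[OF M]]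
  have Z: "Z \<in> carrier_mat k 1" using R B by (auto simp: Z_def)
  have D: "D \<in> carrier_mat 1 1" by (simp add: D_def)
  have "M * Z = (M * inv_mat M) * B"
    unfolding Z_def by (rule assoc_mult_mat[OF M(1) R(1) B, symmetric])
  then have MZ: "M * Z = B" using R B by simp
  define F where "F = mat_adjoint B * Z"
  have aB: "mat_adjoint B \<in> carrier_mat 1 k" using B by auto
  have F: "F \<in> carrier_mat 1 1" unfolding F_def using aB Z by auto
  have DF: "D - F \<in> carrier_mat 1 1" using D F by auto
  have z: "col Z 0 \<in> carrier_vec k" using Z col_dim[of Z 0] by simp
  \<comment> \<open>Replacing \<open>B\<close> by \<open>M * Z\<close> exhibits
    \<open>B^* M^{-1} B\<close> as a value of the form of \<open>M\<close>, whence its sign.\<close>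
  have "F = mat_adjoint Z * M * Z"
    using mat_adjoint_mult[OF M(1) Z] M(2)
    by (simp add: F_def MZ pos_def_mat_def hermitian_mat_def)
  then have "F $$ (0, 0) = (M *\<^sub>v col Z 0) \<bullet>c col Z 0"
    using index_congruence[OF M(1) Z, of 0 0] by simp
  then have "0 \<le> F $$ (0, 0)"
    using pos_def_imp_pos_semidef[OF M(2)] M(1) z by (auto simp: pos_semidef_mat_def)
  \<comment> \<open>Block LU factorisation of the bordered matrix; the triangular factors have
    determinants \<open>det M\<close> and \<open>d - F $$ (0, 0)\<close>.\<close>
  have "four_block_mat M (0\<^sub>m k 1) (mat_adjoint B) (1\<^sub>m 1) * four_block_mat (1\<^sub>m k) Z (0\<^sub>m 1 k) (D - F) =
    four_block_mat (M * 1\<^sub>m k + 0\<^sub>m k 1 * 0\<^sub>m 1 k) (M * Z + 0\<^sub>m k 1 * (D - F))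
      (mat_adjoint B * 1\<^sub>m k + 1\<^sub>m 1 * 0\<^sub>m 1 k) (mat_adjoint B * Z + 1\<^sub>m 1 * (D - F))"
    using M Z aB DF by (intro mult_four_block_mat) auto
  also have "M * 1\<^sub>m k + 0\<^sub>m k 1 * 0\<^sub>m 1 k = M" using M by simp
  also have "M * Z + 0\<^sub>m k 1 * (D - F) = B"
    using MZ B left_mult_zero_mat[OF DF] by simp
  also have "mat_adjoint B * 1\<^sub>m k + 1\<^sub>m 1 * 0\<^sub>m 1 k = mat_adjoint B"
    using right_mult_one_mat[OF aB] aB by simp
  also have "mat_adjoint B * Z + 1\<^sub>m 1 * (D - F) = D"
    unfolding left_mult_one_mat[OF DF] F_def[symmetric] using D F by (intro eq_matI) auto
  finally have "det (four_block_mat M B (mat_adjoint B) D) =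
    det (four_block_mat M (0\<^sub>m k 1) (mat_adjoint B) (1\<^sub>m 1)) * det (four_block_mat (1\<^sub>m k) Z (0\<^sub>m 1 k) (D - F))"
    using det_mult[OF four_block_carrier_mat[OF M(1) one_carrier_mat[of 1]] four_block_carrier_mat[OF one_carrier_mat[of k] DF]]
    by metis
  also have "\<dots> = det M * (d - F $$ (0, 0))"
    using det_four_block_mat_upper_right_zero[OF M(1) refl aB one_carrier_mat]
      det_four_block_mat_lower_left_zero[OF one_carrier_mat Z refl DF] det_single[OF DF] D F
    by (simp add: D_def)
  finally show ?thesis using that \<open>0 \<le> F $$ (0, 0)\<close> unfolding D_def by blast
qed

text \<open>Padding \<open>R\<close> with zero rows gives a square matrix of determinant 0 whose
  kernel vectors are also killed by \<open>R\<close>.\<close>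

lemma wide_mat_kernel_nonzero:
  fixes R :: "'a :: idom mat"
  assumes R: "R \<in> carrier_mat k n" and "k < n"
  obtains v where "v \<in> carrier_vec n" "v \<noteq> 0\<^sub>v n" "R *\<^sub>v v = 0\<^sub>v k"
proof -
  define M where "M = mat_of_rows n (map (\<lambda>i. if i < k then row R i else 0\<^sub>v n) [0..<n])"
  have M: "M \<in> carrier_mat n n" by (simp add: M_def mat_of_rows_def)
  have rows: "row M i = (if i < k then row R i else 0\<^sub>v n)" if "i < n" for i
    unfolding M_def using that R by (subst mat_of_rows_row) auto
  have "det M = 0"
  proof -
    \<comment> \<open>As \<open>k < n\<close>, the last row is one of the padding rows.\<close>
    have "row M (n - 1) = 0\<^sub>v n" using rows[of "n - 1"] \<open>k < n\<close> by auto
    then have "M $$ (n - 1, j) = 0" if "j < n" for j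
      using index_row(1)[of "n - 1" M j] M that \<open>k < n\<close> by simp
    then have "M = mat\<^sub>r n n (\<lambda>i. if i = n - 1 then 0\<^sub>v n else row M i)"
      using M by (intro eq_matI) auto
    then show ?thesis using det_row_0[of "n - 1" n "row M"] M \<open>k < n\<close> by auto
  qed
  then obtain v where v: "v \<in> carrier_vec n" "v \<noteq> 0\<^sub>v n" "M *\<^sub>v v = 0\<^sub>v n"
    using det_0_iff_vec_prod_zero[OF M] by auto
  have "R *\<^sub>v v = 0\<^sub>v k"
  proof (rule eq_vecI)
    fix i assume "i < dim_vec (0\<^sub>v k :: 'a vec)"
    then have i: "i < k" "i < n" using \<open>k < n\<close> by auto
    then have "(R *\<^sub>v v) $ i = (M *\<^sub>v v) $ i" using R M rows by simp
    then show "(R *\<^sub>v v) $ i = 0\<^sub>v k $ i" using v i by simp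
  qed (use R in auto)
  with v show ?thesis using that by blast
qed

text \<open>Positive complex numbers are real in this order, so the comparison of ratios can be
  carried out over the reals.\<close>

lemma complex_pos_obtain:
  fixes z :: complex
  assumes "0 < z"
  obtains r where "0 < r" "z = complex_of_real r"
  using assms that[of "Re z"] by (auto simp: less_complex_def complex_eq_iff)

lemma complex_nonneg_obtain:
  fixes z :: complex
  assumes "0 \<le> z"
  obtains r where "0 \<le> r" "z = complex_of_real r"
  using assms that[of "Re z"] by (auto simp: less_eq_complex_def complex_eq_iff)

text \<open>The border \<open>B\<close> is \<open>P^* N v\<close>; the bottom row is its adjoint
  because \<open>N\<close> is Hermitian.\<close>

lemma bordered_congruence:
  fixes N P :: "complex mat"
  assumes N: "N \<in> carrier_mat n n" "hermitian_mat N" and P: "P \<in> carrier_mat n k"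
    and v: "v \<in> carrier_vec n" and Q: "Q \<in> carrier_mat n (Suc k)"
    and colQ: "\<forall>j<k. col Q j = col P j" "col Q k = v"
  defines "B \<equiv> mat k 1 (\<lambda>(i, _). (N *\<^sub>v v) \<bullet>c col P i)"
  shows "mat_adjoint Q * N * Q =
    four_block_mat (mat_adjoint P * N * P) B (mat_adjoint B) (mat 1 1 (\<lambda>_. (N *\<^sub>v v) \<bullet>c v))"
    (is "_ = ?F")
proof (rule eq_matI)
  have B: "B \<in> carrier_mat k 1" by (simp add: B_def)
  fix i j assume "i < dim_row ?F" "j < dim_col ?F"
  then have ij: "i < Suc k" "j < Suc k" using P by auto
  have c: "col P i \<in> carrier_vec n" for i using P col_dim[of P i] by simp
  have "?F $$ (i, j) = (N *\<^sub>v col Q j) \<bullet>c col Q i"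
  proof (cases "i < k"; cases "j < k")
    assume "i < k" "j < k"
    then show ?thesis using index_congruence[OF N(1) P, of i j] P B colQ by simp
  next
    assume "i < k" "\<not> j < k"
    moreover have "j = k" using ij \<open>\<not> j < k\<close> by simp
    ultimately show ?thesis using P B colQ by (simp add: B_def)
  next
    assume "\<not> i < k" "j < k"
    moreover have "i = k" using ij \<open>\<not> i < k\<close> by simp
    ultimately show ?thesis
      using P B colQ hermitian_form_swap[OF N v c, of j] by (simp add: B_def)
  next
    assume "\<not> i < k" "\<not> j < k"
    moreover have "i = k" "j = k" using ij \<open>\<not> i < k\<close> \<open>\<not> j < k\<close> by auto
    ultimately show ?thesis using P B colQ by simp
  qed
  then show "(mat_adjoint Q * N * Q) $$ (i, j) = ?F $$ (i, j)"
    using index_congruence[OF N(1) Q ij] by simp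
qed (use P Q in \<open>auto simp: B_def\<close>)

text \<open>\<open>P^* A\<close> has fewer rows than columns, so it kills some nonzero
  \<open>v\<close>. Such a \<open>v\<close> is orthogonal to the range of \<open>P\<close> in the
  inner product given by \<open>A\<close>, which keeps the enlarged matrix injective.\<close>

lemma append_orthogonal_column:
  fixes A P :: "complex mat"
  assumes A: "A \<in> carrier_mat n n" "pos_def_mat A"
    and P: "P \<in> carrier_mat n k" and "k < n"
    and inj: "\<forall>x\<in>carrier_vec k. P *\<^sub>v x = 0\<^sub>v n \<longrightarrow> x = 0\<^sub>v k"
  obtains v Q where "v \<in> carrier_vec n" "v \<noteq> 0\<^sub>v n" "Q \<in> carrier_mat n (Suc k)"
    "\<forall>j<k. col Q j = col P j" "col Q k = v"
    "\<forall>j<k. (A *\<^sub>v v) \<bullet>c col P j = 0"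
    "\<forall>x\<in>carrier_vec (Suc k). Q *\<^sub>v x = 0\<^sub>v n \<longrightarrow> x = 0\<^sub>v (Suc k)"
proof -
  have aP: "mat_adjoint P \<in> carrier_mat k n" using P by auto
  obtain v where v: "v \<in> carrier_vec n" "v \<noteq> 0\<^sub>v n" "(mat_adjoint P * A) *\<^sub>v v = 0\<^sub>v k"
    using wide_mat_kernel_nonzero[OF mult_carrier_mat[OF aP A(1)] \<open>k < n\<close>] by blast
  have Av: "A *\<^sub>v v \<in> carrier_vec n" using A v by auto
  have PAv: "mat_adjoint P *\<^sub>v (A *\<^sub>v v) = 0\<^sub>v k"
    using v(3) assoc_mult_mat_vec[OF aP A(1) v(1)] by simp
  have orth: "(A *\<^sub>v v) \<bullet>c (P *\<^sub>v x) = 0" if x: "x \<in> carrier_vec k" for x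
    using cscalar_prod_adjoint[OF aP Av x] PAv x by simp
  have orth': "(A *\<^sub>v v) \<bullet>c col P j = 0" if "j < k" for j
  proof -
    have c: "col P j \<in> carrier_vec n" using P col_dim[of P j] by simp
    have "row (mat_adjoint P) j = conjugate (col P j)"
      using P that by (intro eq_vecI) auto
    then have "(mat_adjoint P *\<^sub>v (A *\<^sub>v v)) $ j = (A *\<^sub>v v) \<bullet>c col P j"
      using P that comm_scalar_prod[OF Av carrier_vec_conjugate[OF c]] by simp
    then show ?thesis using PAv that by simp
  qed
  define Q where "Q = mat n (Suc k) (\<lambda>(i, j). if j < k then P $$ (i, j) else v $ i)"
  have Q: "Q \<in> carrier_mat n (Suc k)" by (simp add: Q_def)
  have colQ: "col Q j = col P j" if "j < k" for j
    using P that by (intro eq_vecI) (auto simp: Q_def)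
  have colQk: "col Q k = v"
    using v by (intro eq_vecI) (auto simp: Q_def)
  have "x = 0\<^sub>v (Suc k)" if x: "x \<in> carrier_vec (Suc k)" "Q *\<^sub>v x = 0\<^sub>v n" for x
  proof -
    define y where "y = vec k (\<lambda>i. x $ i)"
    have y: "y \<in> carrier_vec k" by (simp add: y_def)
    have Py: "P *\<^sub>v y \<in> carrier_vec n" using P y by auto
    have "Q *\<^sub>v x = P *\<^sub>v y + x $ k \<cdot>\<^sub>v v"
      using P v x(1) by (intro eq_vecI) (auto simp: Q_def y_def scalar_prod_def mult.commute intro!: sum.cong)
    then have eq: "P *\<^sub>v y + x $ k \<cdot>\<^sub>v v = 0\<^sub>v n" using x by simp
    \<comment> \<open>Pairing the relation with \<open>A v\<close> removes the part in the range of
      \<open>P\<close> and isolates the last coefficient.\<close>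
    have "0 = (A *\<^sub>v v) \<bullet>c (P *\<^sub>v y + x $ k \<cdot>\<^sub>v v)"
      unfolding eq using Av by simp
    also have "\<dots> = (A *\<^sub>v v) \<bullet>c (P *\<^sub>v y) + cnj (x $ k) * ((A *\<^sub>v v) \<bullet>c v)"
      using Av Py v by (simp add: conjugate_add_vec[of _ n] conjugate_smult_vec scalar_prod_add_distrib[of _ n])
    finally have "cnj (x $ k) * ((A *\<^sub>v v) \<bullet>c v) = 0" using orth[OF y] by simp
    moreover have "0 < (A *\<^sub>v v) \<bullet>c v" using A v by (auto simp: pos_def_mat_def)
    ultimately have xk: "x $ k = 0" by auto
    have "0 \<cdot>\<^sub>v v = 0\<^sub>v n" using v by (intro eq_vecI) auto
    then have "P *\<^sub>v y = 0\<^sub>v n" using eq xk Py by simp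
    then have "y = 0\<^sub>v k" using inj y by blast
    then have "x $ i = 0" if "i < k" for i
      using that by (metis index_vec index_zero_vec(1) y_def)
    then show ?thesis using x xk by (intro eq_vecI) (auto simp: less_Suc_eq)
  qed
  then show ?thesis using v Q colQ colQk orth' by (intro that) auto
qed

text \<open>For \<open>A\<close> the border vanishes and the new factor is
  \<open>a = v^* A v\<close>; for \<open>G\<close> it is \<open>g - t\<close> with
  \<open>g = v^* G v \<le> a\<close> and a Schur correction \<open>t \<ge> 0\<close>. So the
  numerator grows by at least as large a factor as the denominator.\<close>

lemma det_ratio_append_column:
  fixes A G P :: "complex mat"
  assumes A: "A \<in> carrier_mat n n" "pos_def_mat A" and G: "G \<in> carrier_mat n n" "pos_def_mat G"
    and le: "\<forall>v\<in>carrier_vec n. (G *\<^sub>v v) \<bullet>c v \<le> (A *\<^sub>v v) \<bullet>c v"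
    and P: "P \<in> carrier_mat n k" and "k < n"
    and inj: "\<forall>x\<in>carrier_vec k. P *\<^sub>v x = 0\<^sub>v n \<longrightarrow> x = 0\<^sub>v k"
  obtains Q where "Q \<in> carrier_mat n (Suc k)"
    "\<forall>x\<in>carrier_vec (Suc k). Q *\<^sub>v x = 0\<^sub>v n \<longrightarrow> x = 0\<^sub>v (Suc k)"
    "det (mat_adjoint P * A * P) / det (mat_adjoint P * G * P)
      \<le> det (mat_adjoint Q * A * Q) / det (mat_adjoint Q * G * Q)"
proof -
  have hA: "hermitian_mat A" and hG: "hermitian_mat G" using A G by (auto simp: pos_def_mat_def)
  obtain v Q where v: "v \<in> carrier_vec n" "v \<noteq> 0\<^sub>v n" and Q: "Q \<in> carrier_mat n (Suc k)"
    and colQ: "\<forall>j<k. col Q j = col P j" "col Q k = v"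
    and orth: "\<forall>j<k. (A *\<^sub>v v) \<bullet>c col P j = 0"
    and injQ: "\<forall>x\<in>carrier_vec (Suc k). Q *\<^sub>v x = 0\<^sub>v n \<longrightarrow> x = 0\<^sub>v (Suc k)"
    using append_orthogonal_column[OF A P \<open>k < n\<close> inj] by blast
  have carr: "mat_adjoint P * A * P \<in> carrier_mat k k" "mat_adjoint P * G * P \<in> carrier_mat k k"
    "mat_adjoint Q * G * Q \<in> carrier_mat (Suc k) (Suc k)"
    using P Q A G by auto
  have pd: "pos_def_mat (mat_adjoint P * A * P)" "pos_def_mat (mat_adjoint P * G * P)"
    "pos_def_mat (mat_adjoint Q * G * Q)"
    using inj injQ by (auto intro: pos_def_congruence[OF A P] pos_def_congruence[OF G P] pos_def_congruence[OF G Q])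
  have "mat k 1 (\<lambda>(i, _). (A *\<^sub>v v) \<bullet>c col P i) = 0\<^sub>m k 1"
    using orth by (intro eq_matI) auto
  then have "mat_adjoint Q * A * Q = four_block_mat (mat_adjoint P * A * P) (0\<^sub>m k 1)
      (0\<^sub>m 1 k) (mat 1 1 (\<lambda>_. (A *\<^sub>v v) \<bullet>c v))"
    using bordered_congruence[OF A(1) hA P v(1) Q colQ] by simp
  then have detA: "det (mat_adjoint Q * A * Q) = det (mat_adjoint P * A * P) * ((A *\<^sub>v v) \<bullet>c v)"
    using det_four_block_mat_lower_left_zero[OF carr(1) zero_carrier_mat refl, of "mat 1 1 (\<lambda>_. (A *\<^sub>v v) \<bullet>c v)" 1]
    by (simp add: det_single)
  obtain s where s: "0 \<le> s"
    and detG: "det (mat_adjoint Q * G * Q) = det (mat_adjoint P * G * P) * ((G *\<^sub>v v) \<bullet>c v - s)"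
    using det_bordered[OF carr(2) pd(2), of "mat k 1 (\<lambda>(i, _). (G *\<^sub>v v) \<bullet>c col P i)" "(G *\<^sub>v v) \<bullet>c v"]
      bordered_congruence[OF G(1) hG P v(1) Q colQ] by auto
  obtain a where a: "0 < a" "(A *\<^sub>v v) \<bullet>c v = complex_of_real a"
    using complex_pos_obtain[of "(A *\<^sub>v v) \<bullet>c v"] A v by (auto simp: pos_def_mat_def)
  obtain g where g: "0 < g" "(G *\<^sub>v v) \<bullet>c v = complex_of_real g"
    using complex_pos_obtain[of "(G *\<^sub>v v) \<bullet>c v"] G v by (auto simp: pos_def_mat_def)
  obtain t where t: "0 \<le> t" "s = complex_of_real t" using complex_nonneg_obtain[OF s] .
  obtain x where x: "0 < x" "det (mat_adjoint P * A * P) = complex_of_real x"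
    using complex_pos_obtain[OF pos_def_det_pos[OF carr(1) pd(1)]] .
  obtain y where y: "0 < y" "det (mat_adjoint P * G * P) = complex_of_real y"
    using complex_pos_obtain[OF pos_def_det_pos[OF carr(2) pd(2)]] .
  \<comment> \<open>The sign of \<open>g - t\<close>, needed for dividing by it, is read back from
    the positive determinant of \<open>Q^* G Q\<close>.\<close>
  have "0 < complex_of_real (y * (g - t))"
    using pos_def_det_pos[OF carr(3) pd(3)] detG y g t by simp
  then have gt: "0 < g - t" using y by (simp add: less_complex_def zero_less_mult_iff)
  have "g \<le> a" using bspec[OF le v(1)] a g by (simp add: less_eq_complex_def)
  have "x / y \<le> (x * a) / (y * (g - t))"
  proof -
    have "x / y = (x * (g - t)) / (y * (g - t))" using gt by simp
    also have "\<dots> \<le> (x * a) / (y * (g - t))"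
      using x y gt \<open>g \<le> a\<close> t by (intro divide_right_mono mult_left_mono) auto
    finally show ?thesis .
  qed
  then have "complex_of_real (x / y) \<le> complex_of_real ((x * a) / (y * (g - t)))"
    by (simp only: less_eq_complex_def Re_complex_of_real Im_complex_of_real simp_thms)
  then have "det (mat_adjoint P * A * P) / det (mat_adjoint P * G * P)
      \<le> det (mat_adjoint Q * A * Q) / det (mat_adjoint Q * G * Q)"
    unfolding detA detG using a g t x y by simp
  then show ?thesis using that Q injQ by blast
qed

text \<open>Downward induction on \<open>k\<close> from \<open>n\<close>: each step appends one
  column. At \<open>k = n\<close> the matrix \<open>P\<close> is invertible and the common factor
  \<open>|det P|^2\<close> cancels.\<close>

theorem det_compression_ratio_le:
  fixes A G P :: "complex mat"
  assumes A: "A \<in> carrier_mat n n" "pos_def_mat A" and G: "G \<in> carrier_mat n n" "pos_def_mat G"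
    and le: "\<forall>v\<in>carrier_vec n. (G *\<^sub>v v) \<bullet>c v \<le> (A *\<^sub>v v) \<bullet>c v"
    and "k \<le> n" "P \<in> carrier_mat n k"
    and "\<forall>x\<in>carrier_vec k. P *\<^sub>v x = 0\<^sub>v n \<longrightarrow> x = 0\<^sub>v k"
  shows "det (mat_adjoint P * A * P) / det (mat_adjoint P * G * P) \<le> det A / det G"
  using assms(6-)
proof (induction k arbitrary: P rule: inc_induct)
  case base
  note P = base(1)
  have dP: "det P \<noteq> 0" using det_0_iff_vec_prod_zero[OF P] base(2) by auto
  have "det (mat_adjoint P * M * P) = cnj (det P) * det M * det P" if "M \<in> carrier_mat n n" for M
  proof -
    have aP: "mat_adjoint P \<in> carrier_mat n n" using P by auto
    show ?thesis
      using det_mult[OF mult_carrier_mat[OF aP that] P] det_mult[OF aP that] det_mat_adjoint[OF P]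
      by simp
  qed
  then show ?case using A G dP by simp
next
  case (step k)
  obtain Q where "Q \<in> carrier_mat n (Suc k)"
    "\<forall>x\<in>carrier_vec (Suc k). Q *\<^sub>v x = 0\<^sub>v n \<longrightarrow> x = 0\<^sub>v (Suc k)"
    "det (mat_adjoint P * A * P) / det (mat_adjoint P * G * P)
      \<le> det (mat_adjoint Q * A * Q) / det (mat_adjoint Q * G * Q)"
    using det_ratio_append_column[OF A G le step.prems(1) step.hyps(2) step.prems(2)] by blast
  then show ?case using step.IH[of Q] by (meson order_trans)
qed

section \<open>Full column rank and the final inequality\<close>

text \<open>Linear independence concerns the set of columns, so repeated columns must be excluded
  first: a repetition leaves fewer than \<open>k\<close> distinct columns and hence a rank below
  \<open>k\<close>.\<close>

lemma full_column_rank_inj: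
  fixes P :: "'a :: field mat"
  assumes P: "P \<in> carrier_mat n k" and "vec_space.rank n P = k"
    and x: "x \<in> carrier_vec k" "P *\<^sub>v x = 0\<^sub>v n"
  shows "x = 0\<^sub>v k"
proof -
  interpret vec_space "TYPE('a)" n .
  have "distinct (cols P)"
  proof (rule ccontr)
    assume "\<not> distinct (cols P)"
    then have lt: "card (set (cols P)) < k"
      using P card_distinct card_length[of "cols P"] by (metis carrier_matD(2) cols_length le_neq_implies_less)
    \<comment> \<open>The rank is the cardinality of any maximal independent set of columns; the
      empty set starts the search for one.\<close>
    obtain S where "maximal S (\<lambda>T. T \<subseteq> set (cols P) \<and> lin_indpt T)"
      using maximal_exists[of "\<lambda>T. T \<subseteq> set (cols P) \<and> lin_indpt T" "card (set (cols P))" "{}"]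
      by (meson List.finite_set card_mono empty_iff empty_subsetI finite_lin_indpt2 rev_finite_subset)
    then have "rank P \<le> card (set (cols P))"
      using rank_card_indpt[OF P] by (simp add: card_mono maximal_def)
    then show False using lt assms(2) by simp
  qed
  then show ?thesis
    using full_rank_lin_indpt[OF P assms(2)] lin_depI[OF P x(1) _ x(2)] by blast
qed

theorem corollary4p13:
  fixes X Y A G P :: "complex mat" and n k :: nat
  assumes "X \<in> carrier_mat n n" and "pos_def_mat X"
    and "Y \<in> carrier_mat n n" and "pos_def_mat Y"
    and "A = (1 / 2) \<cdot>\<^sub>m (X + Y)" and "G = X \<sharp> Y"
    and "k \<le> n" and "P \<in> carrier_mat n k"
    and "vec_space.rank n P = k"
  shows "det (mat_adjoint P * A * P) / det (mat_adjoint P * G * P) \<le> det A / det G"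
proof -
  have G: "G \<in> carrier_mat n n" "pos_def_mat G"
    and le: "\<forall>v\<in>carrier_vec n. (G *\<^sub>v v) \<bullet>c v \<le> (A *\<^sub>v v) \<bullet>c v"
    using geometric_mean_mat[OF assms(1-4)] assms(5,6) by auto
  have A: "A \<in> carrier_mat n n" using assms by auto
  have "hermitian_mat A"
    unfolding hermitian_mat_def
  proof (rule eq_matI)
    fix i j assume "i < dim_row A" "j < dim_col A"
    then have ij: "i < n" "j < n" using A by auto
    have "cnj (X $$ (j, i)) = X $$ (i, j)" "cnj (Y $$ (j, i)) = Y $$ (i, j)"
      using assms(1-4) ij index_mat_adjoint[of i X j] index_mat_adjoint[of i Y j]
      by (auto simp: pos_def_mat_def hermitian_mat_def)
    then show "mat_adjoint A $$ (i, j) = A $$ (i, j)" using assms ij by auto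
  qed (use A in auto)
  \<comment> \<open>Positivity of the arithmetic mean is inherited from \<open>G\<close> through the
    comparison of the means.\<close>
  moreover have "0 < (A *\<^sub>v v) \<bullet>c v" if "v \<in> carrier_vec n" "v \<noteq> 0\<^sub>v n" for v
    using bspec[OF le that(1)] G that by (auto simp: pos_def_mat_def intro: less_le_trans)
  ultimately have "pos_def_mat A" using A by (auto simp: pos_def_mat_def)
  then show ?thesis
    using det_compression_ratio_le[OF A _ G le assms(7,8)] full_column_rank_inj[OF assms(8,9)] \<open>pos_def_mat A\<close>
    by blast
qed

end
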